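(* Let $m\ge1$ be an integer, and suppose there exists an integer $n\ge2$ such that $\tilde{H}(n,m)$ is not maximal as an $m$-distance set in $V_{n,m}\cong\mathbb{R}^{m(n-1)}$. Then the maximum value of $n$ for which $\tilde{H}(n,m)$ is not maximal as an $m$-distance set equals $m^2+m-1$.
   Context: $\tilde{H}(n,m)=\{\sum_{i=1}^m\mathbf{e}_{(i-1)n+x_i}:(x_1,\ldots,x_m)\in\{1,\ldots,n\}^m\}\subset\mathbb{R}^{mn}$, where $\mathbf{e}_1,\ldots,\mathbf{e}_{mn}$ is the standard basis (the Euclidean representation of the Hamming graph $H(n,m)$); it is an $m$-distance set, i.e. the set of Euclidean distances between its distinct points has exactly $m$ elements ($\sqrt2,\ldots,\sqrt{2m}$). It lies in the affine subspace $V_{n,m}=\{\mathbf{x}\in\mathbb{R}^{mn}:\sum_{i=(k-1)n+1}^{kn}x_i=1,\ k=1,\ldots,m\}$ of dimension $m(n-1)$. An $m$-distance set $X\subset V_{n,m}$ is maximal if there is no $\mathbf{x}\in V_{n,m}\setminus X$ with $X\cup\{\mathbf{x}\}$ still an $m$-distance set. *)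

theory Defs
  imports "HOL-Analysis.Analysis"
begin

text \<open>The dimension \<open>m * n\<close> varies inside the statement, so \<open>\<real>\<^sup>N\<close> is modelled as the set of
  functions \<open>nat \<Rightarrow> real\<close> that vanish outside the index set \<open>{1..N}\<close>.\<close>

definition euclid :: "nat \<Rightarrow> (nat \<Rightarrow> real) set" where
  "euclid N = {x. \<forall>i. i \<notin> {1..N} \<longrightarrow> x i = 0}"

definition euclid_dist :: "nat \<Rightarrow> (nat \<Rightarrow> real) \<Rightarrow> (nat \<Rightarrow> real) \<Rightarrow> real" where
  "euclid_dist N x y = L2_set (\<lambda>i. x i - y i) {1..N}"

definition std_basis :: "nat \<Rightarrow> nat \<Rightarrow> real" where
  "std_basis j = (\<lambda>i. if i = j then 1 else 0)"

definition distances :: "nat \<Rightarrow> (nat \<Rightarrow> real) set \<Rightarrow> real set" where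
  "distances N X = {euclid_dist N x y | x y. x \<in> X \<and> y \<in> X \<and> x \<noteq> y}"

definition m_distance_set :: "nat \<Rightarrow> nat \<Rightarrow> (nat \<Rightarrow> real) set \<Rightarrow> bool" where
  "m_distance_set N m X \<longleftrightarrow>
     X \<subseteq> euclid N \<and> finite (distances N X) \<and> card (distances N X) = m"

definition hamming_rep :: "nat \<Rightarrow> nat \<Rightarrow> (nat \<Rightarrow> real) set" where
  "hamming_rep n m =
     {(\<lambda>j. \<Sum>i=1..m. std_basis ((i - 1) * n + x i) j) | x. x \<in> {1..m} \<rightarrow>\<^sub>E {1..n}}"

definition hamming_space :: "nat \<Rightarrow> nat \<Rightarrow> (nat \<Rightarrow> real) set" where
  "hamming_space n m =
     {x \<in> euclid (m * n). \<forall>k\<in>{1..m}. (\<Sum>i=(k - 1) * n + 1..k * n. x i) = 1}"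

definition maximal_m_distance_set :: "nat \<Rightarrow> nat \<Rightarrow> (nat \<Rightarrow> real) set \<Rightarrow> bool" where
  "maximal_m_distance_set n m X \<longleftrightarrow>
     X \<subseteq> hamming_space n m \<and> m_distance_set (m * n) m X \<and>
     \<not> (\<exists>x \<in> hamming_space n m - X. m_distance_set (m * n) m (X \<union> {x}))"

end

theory Submission
  imports Defs
begin

text \<open>Let \<open>x\<close> be a point that can be added to the Hamming representation. Its coordinates inside a
  block differ by integers, so on block \<open>k\<close> they are \<open>z\<^sub>i - e\<^sub>k / n\<close> with \<open>z\<^sub>i\<close> integral,
  \<open>\<Sum>i. z\<^sub>i = 1 + e\<^sub>k\<close> and \<open>- n \<le> 2 e\<^sub>k < n\<close>. The squared distance from \<open>x\<close> to the vertex \<open>c\<close> is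
  the sum over \<open>k\<close> of \<open>(\<Sum>i. z\<^sub>i\<^sup>2) + 1 - 2 z\<^bsub>c k\<^esub> - e\<^sub>k\<^sup>2 / n\<close>. Hence \<open>n\<close> divides \<open>\<Sum>k. e\<^sub>k\<^sup>2\<close>, while
  the bound \<open>2 m\<close> on the largest squared distance keeps the \<open>e\<^sub>k\<close> small; if \<open>n \<ge> m\<^sup>2 + m\<close> all
  \<open>e\<^sub>k\<close> vanish and \<open>x\<close> is a vertex. For \<open>n = m\<^sup>2 + m - 1\<close> the extremal case
  \<open>e = (- m, - 1, \<dots>, - 1)\<close> is realised.\<close>

section \<open>Block coordinates\<close>

lemma sum_block_shift:
  fixes f :: "nat \<Rightarrow> 'a::comm_monoid_add" and k n :: nat
  assumes "k \<ge> 1"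
  shows "(\<Sum>i=(k - 1) * n + 1..k * n. f i) = (\<Sum>i=1..n. f ((k - 1) * n + i))"
proof -
  have "k * n = (k - 1) * n + n" using assms by (cases k) auto
  then show ?thesis
    by (intro sum.reindex_bij_witness[of _ "\<lambda>i. (k - 1) * n + i" "\<lambda>i. i - (k - 1) * n"]) auto
qed

lemma sum_blocks:
  fixes f :: "nat \<Rightarrow> 'a::comm_monoid_add"
  shows "(\<Sum>i=1..m * n. f i) = (\<Sum>k=1..m. \<Sum>i=1..n. f ((k - 1) * n + i))"
proof (induction m)
  case (Suc m)
  have "(\<Sum>i=1..Suc m * n. f i) = (\<Sum>i=1..m * n. f i) + (\<Sum>i=m * n + 1..m * n + n. f i)"
    by (subst sum.ub_add_nat[symmetric]) (auto simp: add.commute)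
  also have "(\<Sum>i=m * n + 1..m * n + n. f i) = (\<Sum>i=1..n. f (m * n + i))"
    using sum_block_shift[of "Suc m" f n] by (simp add: add.commute)
  finally show ?case using Suc by simp
qed simp

lemma block_index_eq_iff:
  fixes k l i j n :: nat
  assumes "k \<ge> 1" "l \<ge> 1" "i \<in> {1..n}" "j \<in> {1..n}"
  shows "(k - 1) * n + i = (l - 1) * n + j \<longleftrightarrow> k = l \<and> i = j"
proof
  assume eq: "(k - 1) * n + i = (l - 1) * n + j"
  \<comment> \<open>Positions start at 1, so it is the offset \<open>b - 1\<close> that is a
    remainder below \<open>n\<close>; division then recovers the block.\<close>
  have "(a * n + (b - 1)) div n = a" if "b \<in> {1..n}" for a b
  proof -
    have "b - 1 < n" "n \<noteq> 0" using that by auto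
    then show ?thesis using div_mult_self3[of n a "b - 1"] div_less[of "b - 1" n] by linarith
  qed
  then have "((k - 1) * n + (i - 1)) div n = k - 1" "((l - 1) * n + (j - 1)) div n = l - 1"
    using assms by blast+
  moreover have "(k - 1) * n + (i - 1) = (l - 1) * n + (j - 1)" using eq assms by auto
  ultimately have "k - 1 = l - 1" by metis
  then show "k = l \<and> i = j" using eq assms by auto
qed simp

lemma block_index_in:
  fixes k i m n :: nat
  assumes "k \<in> {1..m}" "i \<in> {1..n}"
  shows "(k - 1) * n + i \<in> {1..m * n}"
proof -
  have "(k - 1) * n + n = k * n" using assms by (cases k) auto
  moreover have "k * n \<le> m * n" using assms by simp
  ultimately have "(k - 1) * n + i \<le> m * n" using assms unfolding atLeastAtMost_iff by linarith
  then show ?thesis using assms by simp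
qed

lemma block_index_cases:
  fixes j m n :: nat
  assumes "j \<in> {1..m * n}"
  obtains k i where "k \<in> {1..m}" "i \<in> {1..n}" "j = (k - 1) * n + i"
proof
  have n: "n > 0" using assms by (cases n) auto
  show "(j - 1) div n + 1 \<in> {1..m}"
    using assms by (auto simp: Suc_le_eq less_mult_imp_div_less)
  show "(j - 1) mod n + 1 \<in> {1..n}" using n by (auto simp: Suc_le_eq)
  show "j = ((j - 1) div n + 1 - 1) * n + ((j - 1) mod n + 1)" using assms by simp
qed

section \<open>Distances to the vertices\<close>

text \<open>Names the point of \<open>hamming_rep\<close> belonging to a word \<open>c\<close>. Only
  the values of \<open>c\<close> on \<open>{1..m}\<close> enter, so the lemmas about it take
  \<open>c\<close> from a plain function set rather than an extensional one.\<close>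

definition vertex :: "nat \<Rightarrow> nat \<Rightarrow> (nat \<Rightarrow> nat) \<Rightarrow> nat \<Rightarrow> real" where
  "vertex n m c = (\<lambda>j. \<Sum>i=1..m. std_basis ((i - 1) * n + c i) j)"

lemma hamming_rep_eq: "hamming_rep n m = vertex n m ` ({1..m} \<rightarrow>\<^sub>E {1..n})"
  by (auto simp: hamming_rep_def vertex_def)

lemma vertex_block:
  assumes "c \<in> {1..m} \<rightarrow> {1..n}" "k \<in> {1..m}" "i \<in> {1..n}"
  shows "vertex n m c ((k - 1) * n + i) = (if i = c k then 1 else 0)"
proof -
  have "vertex n m c ((k - 1) * n + i) = (\<Sum>l=1..m. if l = k then (if i = c k then 1 else 0) else 0)"
    unfolding vertex_def std_basis_def
  proof (rule sum.cong)
    fix l assume "l \<in> {1..m}"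
    then have "(k - 1) * n + i = (l - 1) * n + c l \<longleftrightarrow> k = l \<and> i = c l"
      using assms by (intro block_index_eq_iff) auto
    then show "(if (k - 1) * n + i = (l - 1) * n + c l then 1 else 0 :: real) =
      (if l = k then (if i = c k then 1 else 0) else 0)" by auto
  qed simp
  then show ?thesis using assms by simp
qed

lemma vertex_in_euclid:
  assumes "c \<in> {1..m} \<rightarrow> {1..n}"
  shows "vertex n m c \<in> euclid (m * n)"
proof -
  have "vertex n m c j = 0" if "j \<notin> {1..m * n}" for j
    unfolding vertex_def std_basis_def
  proof (intro sum.neutral ballI)
    fix l assume "l \<in> {1..m}"
    then have "(l - 1) * n + c l \<in> {1..m * n}" using assms by (intro block_index_in) auto
    then show "(if j = (l - 1) * n + c l then 1 else 0 :: real) = 0" using that by auto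
  qed
  then show ?thesis by (auto simp: euclid_def)
qed

lemma vertex_in_hamming_space:
  assumes "c \<in> {1..m} \<rightarrow> {1..n}"
  shows "vertex n m c \<in> hamming_space n m"
proof -
  have "(\<Sum>i=(k - 1) * n + 1..k * n. vertex n m c i) = 1" if k: "k \<in> {1..m}" for k
  proof -
    have "(\<Sum>i=(k - 1) * n + 1..k * n. vertex n m c i) = (\<Sum>i=1..n. vertex n m c ((k - 1) * n + i))"
      using k by (intro sum_block_shift) auto
    also have "\<dots> = (\<Sum>i=1..n. if i = c k then 1 else 0)"
      using vertex_block[OF assms k] by (intro sum.cong) auto
    also have "\<dots> = 1" using assms k by auto
    finally show ?thesis .
  qed
  then show ?thesis using vertex_in_euclid[OF assms] by (auto simp: hamming_space_def)
qed

lemma euclid_eqI: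
  assumes "x \<in> euclid (m * n)" "y \<in> euclid (m * n)"
    and "\<And>k i. k \<in> {1..m} \<Longrightarrow> i \<in> {1..n} \<Longrightarrow> x ((k - 1) * n + i) = y ((k - 1) * n + i)"
  shows "x = y"
proof
  fix j show "x j = y j"
  proof (cases "j \<in> {1..m * n}")
    case True
    then show ?thesis using assms(3) by (metis block_index_cases)
  next
    case False
    then show ?thesis using assms(1,2) by (auto simp: euclid_def)
  qed
qed

lemma euclid_dist_commute: "euclid_dist N x y = euclid_dist N y x"
  by (simp add: euclid_dist_def L2_set_def power2_commute)

text \<open>When the square is expanded, the vertex matters in block \<open>k\<close> only at
  position \<open>c k\<close>. The squared distance is thus a sum of block terms, the
  \<open>k\<close>-th depending on the word only through its letter \<open>c k\<close>.\<close>

lemma euclid_dist_vertex: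
  assumes "c \<in> {1..m} \<rightarrow> {1..n}"
  shows "(euclid_dist (m * n) x (vertex n m c))\<^sup>2 =
    (\<Sum>k=1..m. (\<Sum>i=1..n. (x ((k - 1) * n + i))\<^sup>2) + 1 - 2 * x ((k - 1) * n + c k))"
proof -
  have "(euclid_dist (m * n) x (vertex n m c))\<^sup>2 = (\<Sum>j=1..m * n. (x j - vertex n m c j)\<^sup>2)"
    by (simp add: euclid_dist_def L2_set_def sum_nonneg)
  also have "\<dots> = (\<Sum>k=1..m. \<Sum>i=1..n. (x ((k - 1) * n + i) - vertex n m c ((k - 1) * n + i))\<^sup>2)"
    by (rule sum_blocks)
  also have "\<dots> = (\<Sum>k=1..m. (\<Sum>i=1..n. (x ((k - 1) * n + i))\<^sup>2) + 1 - 2 * x ((k - 1) * n + c k))"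
  proof (rule sum.cong)
    fix k assume k: "k \<in> {1..m}"
    have "(\<Sum>i=1..n. (x ((k - 1) * n + i) - vertex n m c ((k - 1) * n + i))\<^sup>2) =
      (\<Sum>i=1..n. (x ((k - 1) * n + i))\<^sup>2 + (if i = c k then 1 - 2 * x ((k - 1) * n + c k) else 0))"
      using vertex_block[OF assms k] by (intro sum.cong) (auto simp: power2_eq_square algebra_simps)
    also have "\<dots> = (\<Sum>i=1..n. (x ((k - 1) * n + i))\<^sup>2) + 1 - 2 * x ((k - 1) * n + c k)"
      using assms k by (auto simp: sum.distrib)
    finally show "(\<Sum>i=1..n. (x ((k - 1) * n + i) - vertex n m c ((k - 1) * n + i))\<^sup>2) =
      (\<Sum>i=1..n. (x ((k - 1) * n + i))\<^sup>2) + 1 - 2 * x ((k - 1) * n + c k)" .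
  qed simp
  finally show ?thesis .
qed

lemma euclid_dist_vertex_vertex:
  assumes c: "c \<in> {1..m} \<rightarrow> {1..n}" and d: "d \<in> {1..m} \<rightarrow> {1..n}"
  shows "euclid_dist (m * n) (vertex n m c) (vertex n m d) =
    sqrt (2 * real (card {k \<in> {1..m}. c k \<noteq> d k}))"
proof -
  have "(euclid_dist (m * n) (vertex n m c) (vertex n m d))\<^sup>2 =
    (\<Sum>k=1..m. if c k \<noteq> d k then 2 else 0)"
    unfolding euclid_dist_vertex[OF d]
  proof (rule sum.cong)
    fix k assume k: "k \<in> {1..m}"
    have "(\<Sum>i=1..n. (vertex n m c ((k - 1) * n + i))\<^sup>2) = (\<Sum>i=1..n. if i = c k then 1 else 0)"
      using vertex_block[OF c k] by (intro sum.cong) auto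
    also have "\<dots> = 1" using c k by auto
    finally show "(\<Sum>i=1..n. (vertex n m c ((k - 1) * n + i))\<^sup>2) + 1
        - 2 * vertex n m c ((k - 1) * n + d k) = (if c k \<noteq> d k then 2 else 0)"
      using vertex_block[OF c k, of "d k"] funcset_mem[OF d k] by auto
  qed simp
  also have "\<dots> = 2 * real (card {k \<in> {1..m}. c k \<noteq> d k})"
    by (subst sum.inter_filter[symmetric]) auto
  finally show ?thesis
    using real_sqrt_unique[of "euclid_dist (m * n) (vertex n m c) (vertex n m d)"]
    by (simp add: euclid_dist_def)
qed

section \<open>The distances within the Hamming representation\<close>

lemma distances_hamming_rep:
  assumes "n \<ge> 2"
  shows "distances (m * n) (hamming_rep n m) = (\<lambda>j. sqrt (2 * real j)) ` {1..m}"
proof (intro equalityI subsetI)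
  fix r assume "r \<in> distances (m * n) (hamming_rep n m)"
  then obtain c d where c: "c \<in> {1..m} \<rightarrow>\<^sub>E {1..n}" and d: "d \<in> {1..m} \<rightarrow>\<^sub>E {1..n}"
    and ne: "vertex n m c \<noteq> vertex n m d"
    and r: "r = euclid_dist (m * n) (vertex n m c) (vertex n m d)"
    unfolding distances_def hamming_rep_eq by auto
  let ?K = "{k \<in> {1..m}. c k \<noteq> d k}"
  have "c \<noteq> d" using ne by auto
  then have "?K \<noteq> {}" using PiE_ext[OF c d] by auto
  then have "card ?K > 0" by (simp add: card_gt_0_iff)
  moreover have "card ?K \<le> m" using card_mono[of "{1..m}" ?K] by fastforce
  ultimately have "card ?K \<in> {1..m}" unfolding atLeastAtMost_iff by linarith
  moreover have "r = sqrt (2 * real (card ?K))"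
    unfolding r using c d by (intro euclid_dist_vertex_vertex) auto
  ultimately show "r \<in> (\<lambda>j. sqrt (2 * real j)) ` {1..m}" by blast
next
  fix r assume "r \<in> (\<lambda>j. sqrt (2 * real j)) ` {1..m}"
  then obtain j where j: "j \<in> {1..m}" and r: "r = sqrt (2 * real j)" by auto
  \<comment> \<open>Two words that differ in exactly the first \<open>j\<close> places; the letter 2
    is available because \<open>n \<ge> 2\<close>.\<close>
  define c where "c = restrict (\<lambda>k. 1::nat) {1..m}"
  define d where "d = restrict (\<lambda>k. if k \<le> j then 2 else 1::nat) {1..m}"
  have cd: "c \<in> {1..m} \<rightarrow>\<^sub>E {1..n}" "d \<in> {1..m} \<rightarrow>\<^sub>E {1..n}"
    using assms by (auto simp: c_def d_def)
  have "{k \<in> {1..m}. c k \<noteq> d k} = {1..j}" using j by (auto simp: c_def d_def)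
  moreover have "euclid_dist (m * n) (vertex n m c) (vertex n m d) =
      sqrt (2 * real (card {k \<in> {1..m}. c k \<noteq> d k}))"
    using cd by (intro euclid_dist_vertex_vertex) auto
  ultimately have "r = euclid_dist (m * n) (vertex n m c) (vertex n m d)"
    using r by simp
  moreover have "vertex n m c \<noteq> vertex n m d"
  proof
    assume "vertex n m c = vertex n m d"
    then have "r = 0" using calculation by (simp add: euclid_dist_def L2_set_def)
    then show False using r j by simp
  qed
  ultimately show "r \<in> distances (m * n) (hamming_rep n m)"
    unfolding distances_def hamming_rep_eq using cd by blast
qed

lemma card_distances_hamming_rep:
  assumes "n \<ge> 2"
  shows "card (distances (m * n) (hamming_rep n m)) = m"
  unfolding distances_hamming_rep[OF assms] by (subst card_image) (auto simp: inj_on_def)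

section \<open>Adding one point to the representation\<close>

lemma distances_insert:
  assumes "x \<notin> X"
  shows "distances N (X \<union> {x}) = distances N X \<union> euclid_dist N x ` X"
proof (intro equalityI subsetI)
  fix r assume "r \<in> distances N (X \<union> {x})"
  then obtain y z where r: "r = euclid_dist N y z" and yz: "y \<in> X \<union> {x}" "z \<in> X \<union> {x}" "y \<noteq> z"
    unfolding distances_def by blast
  then consider "y \<in> X" "z \<in> X" | "y = x" "z \<in> X" | "y \<in> X" "z = x" by blast
  then show "r \<in> distances N X \<union> euclid_dist N x ` X"
  proof cases
    case 1
    then show ?thesis using r yz(3) unfolding distances_def by blast
  next
    case 2
    then show ?thesis using r by blast
  next
    case 3
    then show ?thesis using r euclid_dist_commute[of N y x] by blast
  qed
next
  fix r assume "r \<in> distances N X \<union> euclid_dist N x ` X"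
  then show "r \<in> distances N (X \<union> {x})" using assms unfolding distances_def by blast
qed

lemma hamming_rep_subset: "hamming_rep n m \<subseteq> hamming_space n m"
  by (auto simp: hamming_rep_eq intro!: vertex_in_hamming_space)

text \<open>The representation already realises \<open>m\<close> distances, so a point may be added
  exactly when it produces no new one. Squaring makes this an arithmetic condition.\<close>

lemma not_maximal_iff:
  assumes "n \<ge> 2"
  shows "\<not> maximal_m_distance_set n m (hamming_rep n m) \<longleftrightarrow>
    (\<exists>x \<in> hamming_space n m - hamming_rep n m. \<forall>c \<in> {1..m} \<rightarrow>\<^sub>E {1..n}.
      \<exists>j\<in>{1..m}. (euclid_dist (m * n) x (vertex n m c))\<^sup>2 = 2 * real j)"
proof -
  let ?H = "hamming_rep n m" and ?D = "distances (m * n) (hamming_rep n m)"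
  have sub: "hamming_space n m \<subseteq> euclid (m * n)" by (auto simp: hamming_space_def)
  have fin: "finite ?D" by (simp add: distances_hamming_rep[OF assms])
  have H: "m_distance_set (m * n) m ?H"
    using sub hamming_rep_subset fin card_distances_hamming_rep[OF assms]
    unfolding m_distance_set_def by blast
  have "m_distance_set (m * n) m (?H \<union> {x}) \<longleftrightarrow> (\<forall>c \<in> {1..m} \<rightarrow>\<^sub>E {1..n}.
      \<exists>j\<in>{1..m}. (euclid_dist (m * n) x (vertex n m c))\<^sup>2 = 2 * real j)"
    (is "_ \<longleftrightarrow> ?R") if x: "x \<in> hamming_space n m - ?H" for x
  proof -
    have d: "distances (m * n) (?H \<union> {x}) = ?D \<union> euclid_dist (m * n) x ` ?H"
      using x by (intro distances_insert) auto
    have "m_distance_set (m * n) m (?H \<union> {x}) \<longleftrightarrow> euclid_dist (m * n) x ` ?H \<subseteq> ?D"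
    proof
      assume "m_distance_set (m * n) m (?H \<union> {x})"
      then have "finite (?D \<union> euclid_dist (m * n) x ` ?H)"
        "card (?D \<union> euclid_dist (m * n) x ` ?H) = card ?D"
        unfolding m_distance_set_def d card_distances_hamming_rep[OF assms] by auto
      then have "?D = ?D \<union> euclid_dist (m * n) x ` ?H" by (intro card_subset_eq) auto
      then show "euclid_dist (m * n) x ` ?H \<subseteq> ?D" by blast
    next
      assume "euclid_dist (m * n) x ` ?H \<subseteq> ?D"
      then have "distances (m * n) (?H \<union> {x}) = ?D" using d by auto
      then show "m_distance_set (m * n) m (?H \<union> {x})"
        using H x sub unfolding m_distance_set_def by auto
    qed
    also have "\<dots> \<longleftrightarrow> ?R"
    proof -
      have "euclid_dist (m * n) x y = sqrt (2 * real j) \<longleftrightarrow> (euclid_dist (m * n) x y)\<^sup>2 = 2 * real j"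
        for y j
      proof -
        have "0 \<le> euclid_dist (m * n) x y" by (simp add: euclid_dist_def)
        then have "(euclid_dist (m * n) x y)\<^sup>2 = 2 * real j \<Longrightarrow> sqrt (2 * real j) = euclid_dist (m * n) x y"
          by (intro real_sqrt_unique)
        moreover have "(sqrt (2 * real j))\<^sup>2 = 2 * real j" by simp
        ultimately show ?thesis by metis
      qed
      then show ?thesis
        unfolding distances_hamming_rep[OF assms]
        unfolding hamming_rep_eq image_subset_iff ball_simps(9) image_iff by simp
    qed
    finally show ?thesis .
  qed
  then show ?thesis
    unfolding maximal_m_distance_set_def using H hamming_rep_subset by auto
qed

section \<open>The upper bound\<close>

text \<open>Integral differences leave one real unknown \<open>y 1\<close>, and the sum condition
  makes \<open>n * y 1\<close> an integer. Division by \<open>n\<close> moves the quotient into the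
  integers \<open>z i\<close> and leaves the remainder \<open>e\<close>.\<close>

lemma integer_block_decomposition:
  fixes y :: "nat \<Rightarrow> real" and n :: nat
  assumes n: "n \<ge> 1" and int: "\<And>i. i \<in> {1..n} \<Longrightarrow> y i - y 1 \<in> \<int>" and sum: "(\<Sum>i=1..n. y i) = 1"
  obtains z :: "nat \<Rightarrow> int" and e :: int where
    "\<And>i. i \<in> {1..n} \<Longrightarrow> y i = z i - e / n" "(\<Sum>i=1..n. z i) = 1 + e" "- int n \<le> 2 * e" "2 * e < n"
proof -
  have "\<forall>i\<in>{1..n}. \<exists>w. y i = y 1 + of_int w"
    using int by (metis Ints_cases add_diff_cancel_left' diff_add_cancel add.commute)
  then obtain w :: "nat \<Rightarrow> int" where w: "\<And>i. i \<in> {1..n} \<Longrightarrow> y i = y 1 + w i"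
    by metis
  \<comment> \<open>The shift by \<open>h\<close> centres the remainder: \<open>e\<close> lies
    between \<open>- h\<close> and \<open>n - 1 - h\<close>.\<close>
  define T h e q where "T = (\<Sum>i=1..n. w i) - 1" and "h = int n div 2"
    and "e = (T + h) mod n - h" and "q = (T + h) div n"
  have T: "T = e + n * q"
    using mult_div_mod_eq[of "int n" "T + h"] unfolding e_def q_def by linarith
  have "(\<Sum>i=1..n. y i) = (\<Sum>i=1..n. y 1 + w i)" using w by (intro sum.cong refl)
  then have "n * y 1 = - of_int T" using sum by (simp add: sum.distrib T_def)
  then have y1: "y 1 = - (e + n * q) / n" using n unfolding T[symmetric] by (simp add: field_simps)
  show thesis
  proof
    show "y i = (w i - q) - e / n" if "i \<in> {1..n}" for i
      unfolding w[OF that] y1 using n by (simp add: field_simps)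
    show "(\<Sum>i=1..n. w i - q) = 1 + e" using T by (simp add: sum_subtractf T_def)
    have "0 \<le> (T + h) mod n" "(T + h) mod n < n" using n by auto
    then show "- int n \<le> 2 * e" "2 * e < n" by (simp_all add: e_def h_def)
  qed
qed

section \<open>Integer costs of the blocks\<close>

lemma abs_sum_le_sum_squares:
  fixes z :: "'a \<Rightarrow> int"
  shows "\<bar>\<Sum>i\<in>I. z i\<bar> \<le> (\<Sum>i\<in>I. (z i)\<^sup>2)"
proof -
  have "\<bar>t\<bar> \<le> t\<^sup>2" for t :: int
    using self_le_power[of "\<bar>t\<bar>" 2] by (cases "t = 0") auto
  then have "(\<Sum>i\<in>I. \<bar>z i\<bar>) \<le> (\<Sum>i\<in>I. (z i)\<^sup>2)" by (intro sum_mono) auto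
  then show ?thesis using sum_abs[of z I] by linarith
qed

lemma exists_nonpos:
  fixes z :: "nat \<Rightarrow> int"
  assumes "(\<Sum>i=1..n. z i) < n"
  obtains i where "i \<in> {1..n}" "z i \<le> 0"
proof -
  have "\<exists>i\<in>{1..n}. z i \<le> 0"
  proof (rule ccontr)
    assume "\<not> ?thesis"
    then have "(\<Sum>i=1..n. (1::int)) \<le> (\<Sum>i=1..n. z i)" by (intro sum_mono) force
    then show False using assms by simp
  qed
  then show thesis using that by blast
qed

text \<open>The right-hand side of the bound is the integral part of a block's contribution to the
  squared distance. The squares sum to at least \<open>\<bar>1 + e\<bar>\<close>, and
  \<open>z i\<close> can be taken negative if \<open>e \<le> - 2\<close> and nonpositive otherwise.
  For \<open>e = - 1\<close> the squares may all vanish, hence the correction by 2.\<close>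

lemma block_cost_lower_bound:
  fixes z :: "nat \<Rightarrow> int" and e :: int and n :: nat
  assumes n: "n \<ge> 2" and sum: "(\<Sum>i=1..n. z i) = 1 + e" and e: "2 * e < n"
  obtains i where "i \<in> {1..n}"
    "2 + \<bar>e\<bar> - (if e = - 1 then 2 else 0) \<le> (\<Sum>i=1..n. (z i)\<^sup>2) + 1 - 2 * z i"
proof (cases "e \<le> - 2")
  case True
  have "\<exists>i\<in>{1..n}. z i < 0"
  proof (rule ccontr)
    assume "\<not> ?thesis"
    then have "0 \<le> (\<Sum>i=1..n. z i)" by (intro sum_nonneg) force
    then show False using sum True by simp
  qed
  then obtain i where "i \<in> {1..n}" "z i < 0" by blast
  then show thesis using that[of i] abs_sum_le_sum_squares[of z "{1..n}"] sum True by simp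
next
  case False
  have "(\<Sum>i=1..n. z i) < n" using sum e n by linarith
  then obtain i where "i \<in> {1..n}" "z i \<le> 0" by (rule exists_nonpos)
  then show thesis using that[of i] abs_sum_le_sum_squares[of z "{1..n}"] sum False by (auto split: if_splits)
qed

text \<open>A nonpositive entry exists and its cost gives a sum of squares of at most 1, the sum of
  the entries. Since \<open>t\<^sup>2 - t\<close> is nonnegative on integers, every entry is 0 or
  1.\<close>

lemma unit_vector_of_block_cost:
  fixes z :: "nat \<Rightarrow> int" and n :: nat
  assumes n: "n \<ge> 2" and sum: "(\<Sum>i=1..n. z i) = 1"
    and cost: "\<And>i. i \<in> {1..n} \<Longrightarrow> (\<Sum>i=1..n. (z i)\<^sup>2) + 1 - 2 * z i \<le> 2"
  obtains c where "c \<in> {1..n}" "\<And>i. i \<in> {1..n} \<Longrightarrow> z i = (if i = c then 1 else 0)"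
proof -
  have "(\<Sum>i=1..n. z i) < n" using sum n by simp
  then obtain i where "i \<in> {1..n}" "z i \<le> 0" by (rule exists_nonpos)
  then have "(\<Sum>i=1..n. (z i)\<^sup>2) \<le> 1" using cost[of i] by linarith
  then have "(\<Sum>i=1..n. (z i)\<^sup>2 - z i) \<le> 0" using sum by (simp add: sum_subtractf)
  moreover have nonneg: "t\<^sup>2 - t \<ge> 0" for t :: int
    using abs_sum_le_sum_squares[of "\<lambda>_. t" "{0::nat}"] by simp
  ultimately have "(\<Sum>i=1..n. (z i)\<^sup>2 - z i) = 0"
    using sum_nonneg[of "{1..n}" "\<lambda>i. (z i)\<^sup>2 - z i"] by force
  then have "\<forall>i\<in>{1..n}. (z i)\<^sup>2 - z i = 0"
    using nonneg by (subst (asm) sum_nonneg_eq_0_iff) auto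
  then have z01: "z i = 0 \<or> z i = 1" if "i \<in> {1..n}" for i
    using that by (auto simp: power2_eq_square)
  then have "(\<Sum>i=1..n. z i) = (\<Sum>i=1..n. if z i = 1 then 1 else 0)"
    by (intro sum.cong) force+
  also have "\<dots> = int (card {i \<in> {1..n}. z i = 1})"
    by (subst sum.inter_filter[symmetric]) auto
  finally have "card {i \<in> {1..n}. z i = 1} = 1" using sum by simp
  then obtain c where "{i \<in> {1..n}. z i = 1} = {c}" by (auto simp: card_1_singleton_iff)
  then have "c \<in> {1..n}" "\<And>i. i \<in> {1..n} \<Longrightarrow> z i = 1 \<longleftrightarrow> i = c" by blast+
  then show thesis using that[of c] z01 by metis
qed

text \<open>The blocks with \<open>e k = - 1\<close>, collected in \<open>P\<close>, are the only
  ones whose cost bound falls below 2. Off \<open>P\<close> the values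
  \<open>\<bar>e k\<bar>\<close> sum to at most \<open>p + w\<close> and turn out to be below
  \<open>m\<close>, so the sum of squares is too small to be a positive multiple of
  \<open>n\<close>.\<close>

lemma block_excess_zero:
  fixes e :: "'a \<Rightarrow> int" and m n :: nat and w :: int
  assumes I: "finite I" "card I = m" and m: "m \<ge> 1" and n: "n \<ge> m\<^sup>2 + m"
    and e: "\<And>k. k \<in> I \<Longrightarrow> 2 * \<bar>e k\<bar> \<le> n"
    and w: "(\<Sum>k\<in>I. (e k)\<^sup>2) = n * w"
    and cost: "(\<Sum>k\<in>I. 2 + \<bar>e k\<bar> - (if e k = - 1 then 2 else 0)) - w \<le> 2 * int m"
  shows "\<forall>k\<in>I. e k = 0"
proof -
  define P where "P = {k \<in> I. e k = - 1}"
  define p where "p = int (card P)"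
  have fin: "finite P" "P \<subseteq> I" using I by (auto simp: P_def)
  have n': "int n \<ge> int m * int m + int m" using n by (simp add: power2_eq_square flip: of_nat_mult of_nat_add)
  have npos: "int n > 0" using n m by (cases n) auto
  have "int m * int m > 0" using m by simp
  then have "int m < n" using n' by linarith
  have split: "(\<Sum>k\<in>I. f k) = (\<Sum>k\<in>P. f k) + (\<Sum>k\<in>I - P. f k)" for f :: "'a \<Rightarrow> int"
    using sum.subset_diff[OF fin(2) I(1), of f] by simp
  have "(\<Sum>k\<in>P. (e k)\<^sup>2) = p" "(\<Sum>k\<in>P. \<bar>e k\<bar>) = p" unfolding p_def by (simp_all add: P_def)
  then have sq: "(\<Sum>k\<in>I - P. (e k)\<^sup>2) = n * w - p"
    and ab: "(\<Sum>k\<in>I. \<bar>e k\<bar>) = p + (\<Sum>k\<in>I - P. \<bar>e k\<bar>)"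
    using w split[of "\<lambda>k. (e k)\<^sup>2"] split[of "\<lambda>k. \<bar>e k\<bar>"] by linarith+
  have "(\<Sum>k\<in>I. if e k = - 1 then 2 else 0) = 2 * p"
    unfolding p_def P_def using I by (subst sum.inter_filter[symmetric]) auto
  then have "(\<Sum>k\<in>I. 2 + \<bar>e k\<bar> - (if e k = - 1 then 2 else 0)) = 2 * int m + (\<Sum>k\<in>I. \<bar>e k\<bar>) - 2 * p"
    using I by (simp add: sum.distrib sum_subtractf)
  then have abO: "(\<Sum>k\<in>I - P. \<bar>e k\<bar>) \<le> p + w" using cost ab by linarith
  have small: "\<bar>e k\<bar> \<le> int m - 1 \<and> p \<le> int m - 1" if k: "k \<in> I - P" for k
  proof -
    have "P \<subset> I" using k fin by auto
    then have "card P < card I" using I by (intro psubset_card_mono) auto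
    then have p: "p \<le> int m - 1" using I by (simp add: p_def)
    have nn: "n * \<bar>e l\<bar> - (e l)\<^sup>2 \<ge> 0" if "l \<in> I" for l
    proof -
      have "\<bar>e l\<bar> * \<bar>e l\<bar> \<le> n * \<bar>e l\<bar>" using e[OF that] by (intro mult_right_mono) auto
      then show ?thesis by (simp add: power2_eq_square abs_mult_self_eq)
    qed
    \<comment> \<open>Take \<open>n\<close> times the bound on absolute values minus the equation
      for squares: \<open>w\<close> cancels and \<open>(n + 1) * p\<close> remains. All summands are
      nonnegative, so each one obeys this bound.\<close>
    have "n * \<bar>e k\<bar> - (e k)\<^sup>2 \<le> (\<Sum>l\<in>I - P. n * \<bar>e l\<bar> - (e l)\<^sup>2)"
      using k I nn by (intro member_le_sum) auto
    also have "\<dots> = n * (\<Sum>l\<in>I - P. \<bar>e l\<bar>) - (n * w - p)"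
      using sq by (simp add: sum_subtractf sum_distrib_left)
    also have "\<dots> \<le> n * (p + w) - (n * w - p)"
      using abO by (intro diff_right_mono mult_left_mono) auto
    also have "\<dots> = (n + 1) * p" by (simp add: algebra_simps)
    also have "\<dots> \<le> (n + 1) * (int m - 1)" using p by (intro mult_left_mono) auto
    finally have le: "n * \<bar>e k\<bar> - \<bar>e k\<bar> * \<bar>e k\<bar> \<le> (int n + 1) * (int m - 1)"
      by (simp add: power2_eq_square add.commute)
    have "\<bar>e k\<bar> < m"
    proof (rule ccontr)
      assume "\<not> \<bar>e k\<bar> < m"
      then have ge: "\<bar>e k\<bar> \<ge> m" by simp
      \<comment> \<open>The product is the difference of \<open>t * (n - t)\<close> at
        \<open>t = \<bar>e k\<bar>\<close> and at \<open>t = m\<close>, so the case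
        \<open>t = m\<close> is the least one.\<close>
      then have "0 \<le> (\<bar>e k\<bar> - m) * (n - \<bar>e k\<bar> - m)"
        using e[of k] k by (intro mult_nonneg_nonneg) auto
      then have "m * (int n - m) \<le> (int n + 1) * (int m - 1)"
        using le by (simp add: algebra_simps)
      \<comment> \<open>The inequality amounts to \<open>n \<le> m\<^sup>2 + m - 1\<close>: here the
        hypothesis on \<open>n\<close> is used at its sharp value.\<close>
      then show False using n' by (simp add: algebra_simps)
    qed
    then show ?thesis using p by simp
  qed
  have w0: "w \<ge> 0" using w npos sum_nonneg[of I "\<lambda>k. (e k)\<^sup>2"] by (simp add: zero_le_mult_iff)
  \<comment> \<open>If all blocks lie in \<open>P\<close>, the squares sum to \<open>m\<close>,
    which is below \<open>n\<close>. Otherwise \<open>p\<close> and the values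
    \<open>\<bar>e k\<bar>\<close> off \<open>P\<close> are at most \<open>m - 1\<close>.\<close>
  have "w < 1"
  proof (cases "I - P = {}")
    case True
    then have "P = I" using fin by auto
    then have "int n * w = m" using sq I by (simp add: p_def)
    then have "int n * w < int n * 1" using \<open>int m < n\<close> by linarith
    then show ?thesis using npos by (simp only: mult_less_cancel_left_pos)
  next
    case False
    then have p: "p \<le> int m - 1" using small by auto
    have "(\<Sum>k\<in>I - P. (e k)\<^sup>2) \<le> (\<Sum>k\<in>I - P. (int m - 1) * \<bar>e k\<bar>)"
    proof (rule sum_mono)
      fix k assume "k \<in> I - P"
      then have "\<bar>e k\<bar> * \<bar>e k\<bar> \<le> (int m - 1) * \<bar>e k\<bar>" using small by (intro mult_right_mono) auto
      then show "(e k)\<^sup>2 \<le> (int m - 1) * \<bar>e k\<bar>" by (simp add: power2_eq_square)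
    qed
    also have "\<dots> \<le> (int m - 1) * (p + w)"
      unfolding sum_distrib_left[symmetric] using abO m by (intro mult_left_mono) auto
    finally have "n * w \<le> m * p + (int m - 1) * w" using sq by (simp add: algebra_simps)
    also have "m * p \<le> m * (int m - 1)" using p by (intro mult_left_mono) auto
    finally have 1: "(n - int m + 1) * w \<le> m * (int m - 1)" by (simp add: algebra_simps)
    show ?thesis
    proof (rule ccontr)
      assume "\<not> w < 1"
      then have "(int m * int m + 1) * 1 \<le> (n - int m + 1) * w"
        using n' \<open>int m < n\<close> by (intro mult_mono) auto
      then show False using 1 by (simp add: algebra_simps)
    qed
  qed
  then have "(\<Sum>k\<in>I. (e k)\<^sup>2) = 0" using w w0 by simp
  then show ?thesis using I by (simp add: sum_nonneg_eq_0_iff)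
qed

lemma extension_bound:
  assumes m: "m \<ge> 1" and n2: "n \<ge> 2"
    and x: "x \<in> hamming_space n m" "x \<notin> hamming_rep n m"
    and dist: "\<And>c. c \<in> {1..m} \<rightarrow>\<^sub>E {1..n} \<Longrightarrow>
      \<exists>j\<in>{1..m}. (euclid_dist (m * n) x (vertex n m c))\<^sup>2 = 2 * real j"
  shows "n \<le> m\<^sup>2 + m - 1"
proof (rule ccontr)
  assume "\<not> ?thesis"
  then have n: "n \<ge> m\<^sup>2 + m" using m by linarith
  let ?y = "\<lambda>k i. x ((k - 1) * n + i)"
  \<comment> \<open>The contribution of block \<open>k\<close> if the word has letter
    \<open>i\<close> there. Inside the sum \<open>i\<close> is rebound; only the last term depends
    on the argument.\<close>
  define F where "F k i = (\<Sum>i=1..n. (?y k i)\<^sup>2) + 1 - 2 * ?y k i" for k i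
  have dist': "\<exists>j\<in>{1..m}. (\<Sum>k=1..m. F k (c k)) = 2 * real j" if c: "c \<in> {1..m} \<rightarrow> {1..n}" for c
  proof -
    have "restrict c {1..m} \<in> {1..m} \<rightarrow>\<^sub>E {1..n}" using c by auto
    from dist[OF this] show ?thesis using c
      by (subst (asm) euclid_dist_vertex) (auto simp: F_def)
  qed
  have change: "(\<Sum>l=1..m. F l ((c(k := i)) l)) - (\<Sum>l=1..m. F l (c l)) = F k i - F k (c k)"
    if "k \<in> {1..m}" for c k i
  proof -
    have "(\<Sum>l=1..m. F l ((c(k := i)) l)) - (\<Sum>l=1..m. F l (c l)) =
      (\<Sum>l=1..m. if l = k then F k i - F k (c k) else 0)"
      unfolding sum_subtractf[symmetric] by (intro sum.cong) auto
    then show ?thesis using that by simp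
  qed
  have ysum: "(\<Sum>i=1..n. ?y k i) = 1" if "k \<in> {1..m}" for k
    using x(1) that sum_block_shift[of k x n] by (auto simp: hamming_space_def)
  have yint: "?y k i - ?y k 1 \<in> \<int>" if k: "k \<in> {1..m}" and i: "i \<in> {1..n}" for k i
  proof -
    define c where "c = (\<lambda>_::nat. 1::nat)"
    have "c \<in> {1..m} \<rightarrow> {1..n}" "c(k := i) \<in> {1..m} \<rightarrow> {1..n}"
      using i n2 by (auto simp: c_def)
    then obtain j j' where "(\<Sum>l=1..m. F l (c l)) = 2 * real j"
      "(\<Sum>l=1..m. F l ((c(k := i)) l)) = 2 * real j'"
      using dist' by metis
    \<comment> \<open>Both squared distances are even integers and differ by
      \<open>- 2 * (?y k i - ?y k 1)\<close>, so evenness yields an integer difference of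
      coordinates.\<close>
    then have "?y k i - ?y k 1 = of_int (int j - int j')"
      using change[OF k, of c i] by (simp add: F_def c_def)
    then show ?thesis by (metis Ints_of_int)
  qed
  have "\<forall>k\<in>{1..m}. \<exists>(z :: nat \<Rightarrow> int) (e :: int). (\<forall>i\<in>{1..n}. ?y k i = of_int (z i) - of_int e / n) \<and>
      (\<Sum>i=1..n. z i) = 1 + e \<and> - int n \<le> 2 * e \<and> 2 * e < n"
  proof
    fix k assume k: "k \<in> {1..m}"
    have "n \<ge> 1" using n2 by simp
    then show "\<exists>(z :: nat \<Rightarrow> int) (e :: int). (\<forall>i\<in>{1..n}. ?y k i = of_int (z i) - of_int e / n) \<and>
      (\<Sum>i=1..n. z i) = 1 + e \<and> - int n \<le> 2 * e \<and> 2 * e < n"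
      by (rule integer_block_decomposition[OF _ yint[OF k] ysum[OF k]]) blast+
  qed
  then obtain z :: "nat \<Rightarrow> nat \<Rightarrow> int" and e :: "nat \<Rightarrow> int" where
    y: "\<And>k i. k \<in> {1..m} \<Longrightarrow> i \<in> {1..n} \<Longrightarrow> ?y k i = of_int (z k i) - of_int (e k) / n"
    and zsum: "\<And>k. k \<in> {1..m} \<Longrightarrow> (\<Sum>i=1..n. z k i) = 1 + e k"
    and e: "\<And>k. k \<in> {1..m} \<Longrightarrow> - int n \<le> 2 * e k \<and> 2 * e k < n"
    by metis
  define G where "G k i = (\<Sum>i=1..n. (z k i)\<^sup>2) + 1 - 2 * z k i" for k i
  \<comment> \<open>With \<open>a = e k / n\<close>, the sum of squares contributes
    \<open>- 2 * a\<close> and the last term \<open>+ 2 * a\<close>. These cancel, and the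
    correction left over does not depend on \<open>i\<close>.\<close>
  have FG: "F k i = of_int (G k i) - (of_int (e k))\<^sup>2 / n" if k: "k \<in> {1..m}" and i: "i \<in> {1..n}" for k i
  proof -
    let ?a = "real_of_int (e k) / n"
    have zs: "(\<Sum>i=1..n. real_of_int (z k i)) = 1 + e k"
      using zsum[OF k] by (metis of_int_1 of_int_add of_int_sum)
    have "(\<Sum>i=1..n. (?y k i)\<^sup>2) = (\<Sum>i=1..n. (of_int (z k i))\<^sup>2 - 2 * ?a * of_int (z k i) + ?a\<^sup>2)"
      by (intro sum.cong refl, subst y[OF k]) (simp_all add: power2_eq_square algebra_simps)
    also have "\<dots> = (\<Sum>i=1..n. (of_int (z k i))\<^sup>2) - 2 * ?a * (1 + e k) + n * ?a\<^sup>2"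
      unfolding sum.distrib sum_subtractf sum_distrib_left[symmetric] zs by simp
    finally have "F k i = of_int (G k i) - 2 * ?a * (1 + e k) + n * ?a\<^sup>2 + 2 * ?a"
      using y[OF k i] by (simp add: F_def G_def)
    then show ?thesis using n2 by (simp add: field_simps power2_eq_square)
  qed
  have FG_sum: "(\<Sum>k=1..m. F k (c k)) = of_int (\<Sum>k=1..m. G k (c k)) - of_int (\<Sum>k=1..m. (e k)\<^sup>2) / n"
    if "c \<in> {1..m} \<rightarrow> {1..n}" for c
  proof -
    have "(\<Sum>k=1..m. F k (c k)) = (\<Sum>k=1..m. of_int (G k (c k)) - (of_int (e k))\<^sup>2 / n)"
      using FG[OF _ funcset_mem[OF that]] by (intro sum.cong) blast+
    then show ?thesis by (simp add: sum_subtractf sum_divide_distrib)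
  qed
  \<comment> \<open>One costly index per block is gathered into a single word \<open>c\<close>,
    whose vertex is far from \<open>x\<close>.\<close>
  have "\<forall>k\<in>{1..m}. \<exists>i\<in>{1..n}. 2 + \<bar>e k\<bar> - (if e k = - 1 then 2 else 0) \<le> G k i"
  proof
    fix k assume k: "k \<in> {1..m}"
    then have "2 * e k < n" using e by blast
    then show "\<exists>i\<in>{1..n}. 2 + \<bar>e k\<bar> - (if e k = - 1 then 2 else 0) \<le> G k i"
      unfolding G_def by (rule block_cost_lower_bound[OF n2 zsum[OF k]]) blast
  qed
  then obtain c where "\<forall>k\<in>{1..m}. c k \<in> {1..n} \<and> 2 + \<bar>e k\<bar> - (if e k = - 1 then 2 else 0) \<le> G k (c k)"
    unfolding Bex_def bchoice_iff by blast
  then have c: "c \<in> {1..m} \<rightarrow> {1..n}"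
    and cG: "\<And>k. k \<in> {1..m} \<Longrightarrow> 2 + \<bar>e k\<bar> - (if e k = - 1 then 2 else 0) \<le> G k (c k)"
    unfolding Pi_iff by blast+
  obtain j where j: "j \<in> {1..m}" and Fc: "(\<Sum>k=1..m. F k (c k)) = 2 * real j"
    using dist'[OF c] by blast
  \<comment> \<open>The fractional corrections must add up to an integer, because the squared
    distance is \<open>2 * j\<close>; \<open>w\<close> is that integer.\<close>
  define w where "w = (\<Sum>k=1..m. G k (c k)) - 2 * int j"
  have "of_int (\<Sum>k=1..m. (e k)\<^sup>2) / real n = of_int w"
    using Fc FG_sum[OF c] by (simp add: w_def)
  then have "real_of_int (\<Sum>k=1..m. (e k)\<^sup>2) = of_int (n * w)"
    using n2 by (simp add: field_simps)
  then have w: "(\<Sum>k=1..m. (e k)\<^sup>2) = n * w" by (simp only: of_int_eq_iff)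
  have "(\<Sum>k=1..m. 2 + \<bar>e k\<bar> - (if e k = - 1 then 2 else 0)) \<le> (\<Sum>k=1..m. G k (c k))"
    using cG by (intro sum_mono) auto
  then have "(\<Sum>k=1..m. 2 + \<bar>e k\<bar> - (if e k = - 1 then 2 else 0)) - w \<le> 2 * int m"
    using j by (simp add: w_def)
  moreover have "2 * \<bar>e k\<bar> \<le> n" if "k \<in> {1..m}" for k using e[OF that] by linarith
  ultimately have "\<forall>k\<in>{1..m}. e k = 0"
    using w m n by (intro block_excess_zero[where m = m and n = n and w = w]) auto
  then have e0: "e k = 0" if "k \<in> {1..m}" for k using that by blast
  have FG0: "F k i = of_int (G k i)" if "k \<in> {1..m}" "i \<in> {1..n}" for k i
    using FG[OF that] e0[OF that(1)] by simp
  have unit: "\<exists>d\<in>{1..n}. \<forall>i\<in>{1..n}. z k i = (if i = d then 1 else 0)" if k: "k \<in> {1..m}" for k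
  proof -
    \<comment> \<open>With all \<open>e k\<close> zero, every block of \<open>c\<close> costs at
      least 2. Replacing the letter at \<open>k\<close> leaves \<open>2 * m - 2\<close> for the
      others, and the total may not exceed \<open>2 * m\<close>.\<close>
    have "G k i \<le> 2" if i: "i \<in> {1..n}" for i
    proof -
      have "c(k := i) \<in> {1..m} \<rightarrow> {1..n}" using c i by auto
      then obtain j where "j \<in> {1..m}" "(\<Sum>l=1..m. F l ((c(k := i)) l)) = 2 * real j"
        using dist' by blast
      then have "(\<Sum>l=1..m. F l ((c(k := i)) l)) \<le> 2 * m" by simp
      then have *: "(\<Sum>l=1..m. F l (c l)) + F k i - F k (c k) \<le> 2 * m"
        using change[OF k, of c i] by linarith
      have "(\<Sum>l\<in>{1..m} - {k}. 2) \<le> (\<Sum>l\<in>{1..m} - {k}. F l (c l))"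
      proof (rule sum_mono)
        fix l assume l: "l \<in> {1..m} - {k}"
        then have "2 \<le> G l (c l)" using cG[of l] e0[of l] by auto
        then show "2 \<le> F l (c l)" using FG0[of l "c l"] l c by (auto simp: Pi_iff)
      qed
      moreover have "(\<Sum>l=1..m. F l (c l)) = F k (c k) + (\<Sum>l\<in>{1..m} - {k}. F l (c l))"
        using k by (intro sum.remove) auto
      moreover have "(\<Sum>l\<in>{1..m} - {k}. 2) = 2 * real m - 2"
        using k by (simp add: card_Diff_singleton of_nat_diff)
      ultimately have "F k i \<le> 2" using * by linarith
      then show ?thesis using FG0[OF k i] by simp
    qed
    moreover have "(\<Sum>i=1..n. z k i) = 1" using zsum[OF k] e0[OF k] by simp
    ultimately show ?thesis unfolding G_def by (metis unit_vector_of_block_cost[OF n2])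
  qed
  then obtain d where d: "\<And>k. k \<in> {1..m} \<Longrightarrow> d k \<in> {1..n}"
    "\<And>k i. k \<in> {1..m} \<Longrightarrow> i \<in> {1..n} \<Longrightarrow> z k i = (if i = d k then 1 else 0)"
    by metis
  define d' where "d' = restrict d {1..m}"
  have d': "d' \<in> {1..m} \<rightarrow>\<^sub>E {1..n}" using d(1) by (auto simp: d'_def)
  then have d'': "d' \<in> {1..m} \<rightarrow> {1..n}" by auto
  have "x = vertex n m d'"
  proof (rule euclid_eqI)
    show "x \<in> euclid (m * n)" using x by (simp add: hamming_space_def)
    show "vertex n m d' \<in> euclid (m * n)" using d'' by (rule vertex_in_euclid)
    show "?y k i = vertex n m d' ((k - 1) * n + i)" if "k \<in> {1..m}" "i \<in> {1..n}" for k i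
      using y[OF that] d(2)[OF that] e0[OF that(1)] vertex_block[OF d'' that] that
      by (simp add: d'_def)
  qed
  then show False using x(2) d' by (auto simp: hamming_rep_eq)
qed

section \<open>The extremal example\<close>

lemma extension_exists:
  assumes m: "m \<ge> 2" and n: "n = m\<^sup>2 + m - 1"
  shows "\<exists>x \<in> hamming_space n m - hamming_rep n m. \<forall>c \<in> {1..m} \<rightarrow>\<^sub>E {1..n}.
      \<exists>j\<in>{1..m}. (euclid_dist (m * n) x (vertex n m c))\<^sup>2 = 2 * real j"
proof -
  \<comment> \<open>First block: \<open>e = - m\<close>, with \<open>z i = - 1\<close> at
    \<open>m - 1\<close> positions and 0 elsewhere. Every other block: \<open>e = - 1\<close> and
    \<open>z = 0\<close>.\<close>
  define x :: "nat \<Rightarrow> real" where "x = (\<lambda>j. if j \<notin> {1..m * n} then 0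
    else if j \<le> n then m / n - (if j \<le> m - 1 then 1 else 0) else 1 / n)"
  have m4: "m * m \<ge> 4" using m mult_mono[of 2 m 2 m] by simp
  have nm: "n \<ge> m" "n \<ge> 2" using m m4 by (auto simp: n power2_eq_square)
  have rn: "real n = real m * real m + real m - 1" using m4 by (simp add: n power2_eq_square of_nat_diff)
  have n0: "real n > 0" using nm by simp
  have x1: "x i = m / n - (if i \<le> m - 1 then 1 else 0)" if "i \<in> {1..n}" for i
    using block_index_in[of 1 m i n] that m by (simp add: x_def)
  have xk: "x ((k - 1) * n + i) = 1 / n" if "k \<in> {2..m}" "i \<in> {1..n}" for k i
  proof -
    have "(k - 1) * n + i \<in> {1..m * n}" using that by (intro block_index_in) auto
    moreover have "1 * n \<le> (k - 1) * n" using that by (intro mult_right_mono) force+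
    moreover have "i \<ge> 1" using that by simp
    ultimately have "\<not> (k - 1) * n + i \<le> n" by linarith
    then show ?thesis using \<open>(k - 1) * n + i \<in> {1..m * n}\<close> unfolding x_def by argo
  qed
  have ind: "(\<Sum>i=1..n. if i \<le> m - 1 then 1 else 0 :: real) = real m - 1"
  proof -
    have "{i \<in> {1..n}. i \<le> m - 1} = {1..m - 1}" using nm by auto
    then show ?thesis using m by (subst sum.inter_filter[symmetric]) (auto simp: of_nat_diff)
  qed
  have ks: "{1..m} = insert 1 {2..m}" using m by auto
  have sum1: "(\<Sum>i=1..n. x i) = 1"
  proof -
    have "(\<Sum>i=1..n. x i) = (\<Sum>i=1..n. m / n - (if i \<le> m - 1 then 1 else 0))"
      using x1 by (intro sum.cong) auto
    then show ?thesis using ind n0 by (simp add: sum_subtractf)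
  qed
  have "(\<Sum>i=(k - 1) * n + 1..k * n. x i) = 1" if k: "k \<in> {1..m}" for k
  proof -
    have eq: "(\<Sum>i=(k - 1) * n + 1..k * n. x i) = (\<Sum>i=1..n. x ((k - 1) * n + i))"
      using k by (intro sum_block_shift) auto
    show ?thesis
    proof (cases "k = 1")
      case True
      then show ?thesis using eq sum1 by simp
    next
      case False
      then have "(\<Sum>i=1..n. x ((k - 1) * n + i)) = (\<Sum>i=1..n. 1 / real n)"
        using xk[of k] k by (intro sum.cong) auto
      then show ?thesis using eq n0 by simp
    qed
  qed
  then have V: "x \<in> hamming_space n m"
    by (auto simp: hamming_space_def euclid_def x_def)
  have "x \<notin> hamming_rep n m"
  proof
    assume "x \<in> hamming_rep n m"
    then obtain c where c: "c \<in> {1..m} \<rightarrow>\<^sub>E {1..n}" and xc: "x = vertex n m c"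
      by (auto simp: hamming_rep_eq)
    \<comment> \<open>The second block exists since \<open>m \<ge> 2\<close>, and its entry
      \<open>1 / n\<close> is neither 0 nor 1.\<close>
    have "vertex n m c ((2 - 1) * n + 1) = (if 1 = c 2 then 1 else 0)"
      using c m nm by (intro vertex_block) auto
    moreover have "x ((2 - 1) * n + 1) = 1 / n" using m nm by (intro xk) auto
    ultimately show False using nm xc by (auto split: if_splits)
  qed
  moreover have "\<exists>j\<in>{1..m}. (euclid_dist (m * n) x (vertex n m c))\<^sup>2 = 2 * real j"
    if "c \<in> {1..m} \<rightarrow>\<^sub>E {1..n}" for c
  proof -
    have c: "c \<in> {1..m} \<rightarrow> {1..n}" using that by auto
    let ?F = "\<lambda>k. (\<Sum>i=1..n. (x ((k - 1) * n + i))\<^sup>2) + 1 - 2 * x ((k - 1) * n + c k)"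
    have "(\<Sum>i=1..n. (x i)\<^sup>2) =
        (\<Sum>i=1..n. (m / n)\<^sup>2 + (1 - 2 * (m / n)) * (if i \<le> m - 1 then 1 else 0))"
      by (intro sum.cong refl, subst x1) (simp_all add: power2_eq_square algebra_simps)
    also have "\<dots> = n * (m / n)\<^sup>2 + (1 - 2 * (m / n)) * (real m - 1)"
      unfolding sum.distrib sum_distrib_left[symmetric] ind by simp
    finally have "?F 1 = n * (m / n)\<^sup>2 + (1 - 2 * (m / n)) * (real m - 1) + 1 - 2 * (m / n)
        + (if c 1 \<le> m - 1 then 2 else 0)"
      using x1[of "c 1"] c m by (auto simp: Pi_iff)
    moreover have "n * (m / n)\<^sup>2 + (1 - 2 * (m / n)) * (real m - 1) + 1 - 2 * (m / n) = m - m * m / n"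
      using n0 by (simp add: field_simps power2_eq_square)
    ultimately have F1: "?F 1 = m - m * m / n + (if c 1 \<le> m - 1 then 2 else 0)" by presburger
    have Fk: "?F k = 1 - 1 / n" if k: "k \<in> {2..m}" for k
    proof -
      have "(\<Sum>i=1..n. (x ((k - 1) * n + i))\<^sup>2) = (\<Sum>i=1..n. (1 / real n)\<^sup>2)"
        using xk[OF k] by (intro sum.cong) auto
      moreover have "x ((k - 1) * n + c k) = 1 / n" using xk[OF k] c k by (auto simp: Pi_iff)
      ultimately show ?thesis using n0 by (simp add: field_simps power2_eq_square)
    qed
    have "(euclid_dist (m * n) x (vertex n m c))\<^sup>2 = (\<Sum>k=1..m. ?F k)"
      using euclid_dist_vertex[OF c] .
    also have "\<dots> = ?F 1 + (\<Sum>k=2..m. ?F k)" unfolding ks by (subst sum.insert) auto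
    also have "(\<Sum>k=2..m. ?F k) = (\<Sum>k=2..m. 1 - 1 / real n)" using Fk by (intro sum.cong) auto
    also have "\<dots> = (real m - 1) * (1 - 1 / n)" using m by (simp add: of_nat_diff)
    also have "?F 1 + (real m - 1) * (1 - 1 / n) =
        2 * real m - 1 - (real m * real m + real m - 1) / n + (if c 1 \<le> m - 1 then 2 else 0)"
      unfolding F1 using n0 by (simp add: field_simps)
    \<comment> \<open>The choice of \<open>n\<close> makes the fraction equal to 1, so only two
      distances to vertices occur.\<close>
    also have "\<dots> = 2 * real (if c 1 \<le> m - 1 then m else m - 1)"
      unfolding rn[symmetric] using n0 m by (simp add: of_nat_diff)
    finally have "(euclid_dist (m * n) x (vertex n m c))\<^sup>2 =
      2 * real (if c 1 \<le> m - 1 then m else m - 1)" .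
    \<comment> \<open>The smaller value \<open>m - 1\<close> is an admissible index because
      \<open>m \<ge> 2\<close>.\<close>
    moreover have "(if c 1 \<le> m - 1 then m else m - 1) \<in> {1..m}" using m by auto
    ultimately show ?thesis by blast
  qed
  ultimately show ?thesis using V by blast
qed

theorem theorem4p6:
  fixes m :: nat
  assumes "m \<ge> 1"
    and "\<exists>n\<ge>2. \<not> maximal_m_distance_set n m (hamming_rep n m)"
  shows "m^2 + m - 1 \<in> {n. n \<ge> 2 \<and> \<not> maximal_m_distance_set n m (hamming_rep n m)}
    \<and> (\<forall>n \<in> {n. n \<ge> 2 \<and> \<not> maximal_m_distance_set n m (hamming_rep n m)}. n \<le> m^2 + m - 1)"
proof -
  have bound: "n \<le> m^2 + m - 1" if "n \<ge> 2" "\<not> maximal_m_distance_set n m (hamming_rep n m)" for n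
    using that(2) extension_bound[OF assms(1) that(1)] unfolding not_maximal_iff[OF that(1)] by blast
  \<comment> \<open>The assumed \<open>n \<ge> 2\<close> obeys the bound; for \<open>m = 1\<close>
    the bound would be 1, so this case is excluded.\<close>
  then have "m^2 + m - 1 \<ge> 2" using assms(2) by force
  moreover from this have "m \<ge> 2" using assms(1) by (cases "m = 1") auto
  ultimately have "\<not> maximal_m_distance_set (m^2 + m - 1) m (hamming_rep (m^2 + m - 1) m)"
    using extension_exists by (subst not_maximal_iff) auto
  then show ?thesis using bound \<open>m^2 + m - 1 \<ge> 2\<close> by blast
qed

end
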